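(* Let $d\ge 2$, let $g\in L^2(\mathbb{R})$ be not identically zero, let $\Lambda\subset\mathbb{R}\times\mathbb{R}\times S^{d-1}$ be a nonempty discrete set, and let $\{g_{m,t,u}\}_{(m,t,u)\in\Lambda}$ be the corresponding discrete directional Gabor system. Then there exists a sequence $\{\phi_n\}_{n=1}^\infty\subset\mathcal{S}(\mathbb{R}^d)$ such that (1) $\lim_{n\to\infty}\|\phi_n\|_2=0$, and (2) $\sum_{(m,t,u)\in\Lambda}|\langle\phi_n,g_{m,t,u}\rangle|^2\ge 1$ for all $n$. In particular, $\{g_{m,t,u}\}_{(m,t,u)\in\Lambda}$ cannot be a frame for any function space containing $\mathcal{S}(\mathbb{R}^d)$; it cannot even be Bessel.
   Context: $\mathcal{S}(\mathbb{R}^d)$ is the Schwartz space and $S^{d-1}$ the unit sphere in $\mathbb{R}^d$. For $g:\mathbb{R}\to\mathbb{C}$, $m,t\in\mathbb{R}$ and $u\in S^{d-1}$, let $g^{m,t}(s)=e^{2\pi i ms}g(s-t)$ for $s\in\mathbb{R}$, and $g_{m,t,u}(x)=g^{m,t}(u\cdot x)$ for $x\in\mathbb{R}^d$. A discrete directional Gabor system is a collection $\{g_{m,t,u}\}_{(m,t,u)\in\Lambda}$ with $\Lambda\subset\mathbb{R}\times\mathbb{R}\times S^{d-1}$ discrete. The pairing is $\langle f,g_{m,t,u}\rangle=\int_{\mathbb{R}^d}f(x)\overline{g_{m,t,u}(x)}\,dx$. The system is Bessel for a space $V$ of functions (with the $L^2$ norm) if there is $B<\infty$ with $\sum_{(m,t,u)\in\Lambda}|\langle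 f,g_{m,t,u}\rangle|^2\le B\|f\|_2^2$ for all $f\in V$, and is a frame for $V$ if moreover there is $A>0$ with $A\|f\|_2^2\le\sum_{(m,t,u)\in\Lambda}|\langle f,g_{m,t,u}\rangle|^2$ for all $f\in V$. *)

theory Defs
  imports "HOL-Analysis.Analysis"
begin

section \<open>Square-integrable functions\<close>

text \<open>Elements of \<open>L\<^sup>2\<close> are represented by functions, not by classes modulo null sets.\<close>

definition square_integrable :: "('a::euclidean_space \<Rightarrow> complex) \<Rightarrow> bool" where
  "square_integrable f \<longleftrightarrow>
     f \<in> borel_measurable lebesgue \<and> integrable lebesgue (\<lambda>x. (cmod (f x))\<^sup>2)"

definition L2norm :: "('a::euclidean_space \<Rightarrow> complex) \<Rightarrow> real" where
  "L2norm f = sqrt (LINT x|lebesgue. (cmod (f x))\<^sup>2)"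

definition L2_function_space :: "('a::euclidean_space \<Rightarrow> complex) set \<Rightarrow> bool" where
  "L2_function_space V \<longleftrightarrow>
     (\<forall>f\<in>V. square_integrable f) \<and>
     (\<lambda>x. 0) \<in> V \<and>
     (\<forall>f\<in>V. \<forall>h\<in>V. (\<lambda>x. f x + h x) \<in> V) \<and>
     (\<forall>f\<in>V. \<forall>c. (\<lambda>x. c * f x) \<in> V)"

section \<open>The Schwartz space\<close>

text \<open>
  \<open>iter_partial is f\<close> is the iterated partial derivative of \<open>f\<close> along the list of coordinate
  indices \<open>is\<close>. Lists take the place of multi-indices: the partial derivatives of a smooth
  function commute, so the order of the entries does not matter.
\<close>

primrec iter_partial :: "'d::finite list \<Rightarrow> (real ^ 'd \<Rightarrow> complex) \<Rightarrow> real ^ 'd \<Rightarrow> complex" where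
  "iter_partial [] f = f"
| "iter_partial (i # is) f =
     (\<lambda>x. frechet_derivative (iter_partial is f) (at x) (axis i 1))"

text \<open>
  A function is smooth iff all its iterated partial derivatives exist and are (totally)
  differentiable everywhere. The differentiability requirement also ensures that
  \<^const>\<open>frechet_derivative\<close> above is the genuine derivative.
\<close>

definition smooth_fun :: "(real ^ 'd::finite \<Rightarrow> complex) \<Rightarrow> bool" where
  "smooth_fun f \<longleftrightarrow> (\<forall>is x. iter_partial is f differentiable (at x))"

definition schwartz_space :: "(real ^ 'd::finite \<Rightarrow> complex) set" where
  "schwartz_space =
     {f. smooth_fun f \<and>
         (\<forall>(\<alpha> :: 'd \<Rightarrow> nat) is. \<exists>C. \<forall>x.
            cmod (of_real (\<Prod>i\<in>UNIV. (x $ i) ^ \<alpha> i) * iter_partial is f x) \<le> C)}"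

section \<open>Directional Gabor systems\<close>

definition gabor :: "(real \<Rightarrow> complex) \<Rightarrow> real \<Rightarrow> real \<Rightarrow> real \<Rightarrow> complex" where
  "gabor g m t s = exp (2 * of_real pi * \<i> * of_real m * of_real s) * g (s - t)"

definition dir_gabor ::
  "(real \<Rightarrow> complex) \<Rightarrow> real \<times> real \<times> (real ^ 'd::finite) \<Rightarrow> real ^ 'd \<Rightarrow> complex" where
  "dir_gabor g = (\<lambda>(m, t, u) x. gabor g m t (u \<bullet> x))"

definition pairing ::
  "('a::euclidean_space \<Rightarrow> complex) \<Rightarrow> ('a \<Rightarrow> complex) \<Rightarrow> complex" where
  "pairing f h = (LINT x|lebesgue. f x * cnj (h x))"

text \<open>The sum takes values in \<open>[0, \<infinity>]\<close>, so it is always meaningful.\<close>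

definition gabor_sum ::
  "(real \<Rightarrow> complex) \<Rightarrow> (real \<times> real \<times> (real ^ 'd::finite)) set
     \<Rightarrow> (real ^ 'd \<Rightarrow> complex) \<Rightarrow> ennreal" where
  "gabor_sum g \<Lambda> f = (\<Sum>\<^sub>\<infinity>l\<in>\<Lambda>. ennreal ((cmod (pairing f (dir_gabor g l)))\<^sup>2))"

definition is_bessel ::
  "(real \<Rightarrow> complex) \<Rightarrow> (real \<times> real \<times> (real ^ 'd::finite)) set
     \<Rightarrow> (real ^ 'd \<Rightarrow> complex) set \<Rightarrow> bool" where
  "is_bessel g \<Lambda> V \<longleftrightarrow>
     (\<exists>B::real. \<forall>f\<in>V. gabor_sum g \<Lambda> f \<le> ennreal (B * (L2norm f)\<^sup>2))"

definition is_frame ::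
  "(real \<Rightarrow> complex) \<Rightarrow> (real \<times> real \<times> (real ^ 'd::finite)) set
     \<Rightarrow> (real ^ 'd \<Rightarrow> complex) set \<Rightarrow> bool" where
  "is_frame g \<Lambda> V \<longleftrightarrow>
     is_bessel g \<Lambda> V \<and>
     (\<exists>A::real. A > 0 \<and> (\<forall>f\<in>V. ennreal (A * (L2norm f)\<^sup>2) \<le> gabor_sum g \<Lambda> f))"

end

theory Submission
  imports Defs "HOL-Probability.Levy"
begin

text \<open>
  A function \<open>x \<mapsto> G (u \<bullet> x)\<close> is constant along the hyperplanes orthogonal to \<open>u\<close>, so for \<open>d \<ge> 2\<close> it is
  not square integrable unless it vanishes almost everywhere, and pairing with it cannot be bounded
  in the \<open>L\<^sup>2\<close> norm. One element \<open>(m, t, u)\<close> of the system already shows the failure: the test functions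
  are fixed in the direction \<open>u\<close> and spread out over the hyperplane \<open>u\<^sup>\<bottom>\<close>.

  The test functions are wave packets \<open>c * exp (- s\<^sup>2 + \<i> \<xi> s) * w\<^sub>a(x)\<close> with \<open>s = u \<bullet> x\<close>, where \<open>w\<^sub>a\<close> is the
  Gaussian \<open>exp (- a |x - s u|\<^sup>2)\<close> normalised to have integral \<open>1\<close> over each hyperplane orthogonal to \<open>u\<close>.
  Three facts about them carry the proof.

  \<^item> Integrating out \<open>u\<^sup>\<bottom>\<close> against \<open>w\<^sub>a\<close> gives \<open>1\<close>, so the pairing with \<open>G (u \<bullet> x)\<close> is the
    one-dimensional integral of \<open>c * exp (- s\<^sup>2 + \<i> \<xi> s)\<close> against the conjugate of \<open>G\<close>, independently of \<open>a\<close>.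
    In contrast, the square of \<open>w\<^sub>a\<close> is \<open>(sqrt (a / 2\<pi>)) ^ (d - 1)\<close> times the weight for \<open>2a\<close>, so the \<open>L\<^sup>2\<close> norm
    tends to \<open>0\<close> with \<open>a\<close>
    (\<open>distr_inner_transversal_gaussian\<close>, \<open>pairing_wave_packet\<close>, \<open>L2norm_wave_packet\<close>).
  \<^item> Some frequency \<open>\<xi>\<close> makes the one-dimensional integral nonzero, since otherwise the integrable
    function \<open>s \<mapsto> exp (- s\<^sup>2) * cnj (G s)\<close> would have vanishing Fourier transform and so be null
    (\<open>fourier_uniqueness\<close>, \<open>ex_nonzero_gaussian_fourier_coefficient\<close>). A suitable \<open>c\<close> then makes every
    pairing equal to \<open>1\<close>.
  \<^item> For \<open>a \<le> 1\<close> a wave packet is a constant times the exponential of a quadratic polynomial whose real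
    part is at most \<open>- a |x|\<^sup>2\<close>, hence a Schwartz function (\<open>polynomial_times_exp_in_schwartz_space\<close>).

  A Bessel bound \<open>B\<close> would give \<open>1 \<le> B \<parallel>\<phi>\<^sub>n\<parallel>\<^sup>2 \<longlonglongrightarrow> 0\<close>.
\<close>

section \<open>Polynomials times Gaussians are Schwartz functions\<close>

inductive coordinate_polynomial :: "(real ^ 'd::finite \<Rightarrow> complex) \<Rightarrow> bool" where
  const: "coordinate_polynomial (\<lambda>x. c)"
| coordinate: "coordinate_polynomial (\<lambda>x. of_real (x $ i))"
| add: "coordinate_polynomial p \<Longrightarrow> coordinate_polynomial q \<Longrightarrow> coordinate_polynomial (\<lambda>x. p x + q x)"
| mult: "coordinate_polynomial p \<Longrightarrow> coordinate_polynomial q \<Longrightarrow> coordinate_polynomial (\<lambda>x. p x * q x)"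

lemma coordinate_polynomial_sum:
  "finite I \<Longrightarrow> (\<And>i. i \<in> I \<Longrightarrow> coordinate_polynomial (p i)) \<Longrightarrow> coordinate_polynomial (\<lambda>x. \<Sum>i\<in>I. p i x)"
  by (induction I rule: finite_induct) (auto intro: coordinate_polynomial.intros)

lemma coordinate_polynomial_prod:
  "finite I \<Longrightarrow> (\<And>i. i \<in> I \<Longrightarrow> coordinate_polynomial (p i)) \<Longrightarrow> coordinate_polynomial (\<lambda>x. \<Prod>i\<in>I. p i x)"
  by (induction I rule: finite_induct) (auto intro: coordinate_polynomial.intros)

lemma coordinate_polynomial_power:
  "coordinate_polynomial p \<Longrightarrow> coordinate_polynomial (\<lambda>x. p x ^ n)"
  by (induction n) (auto intro: coordinate_polynomial.intros)

lemma coordinate_polynomial_inner: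
  "coordinate_polynomial (\<lambda>x. of_real (u \<bullet> x))"
  unfolding inner_vec_def of_real_sum inner_real_def of_real_mult
  by (intro coordinate_polynomial_sum coordinate_polynomial.intros) simp

lemma coordinate_polynomial_norm_square:
  "coordinate_polynomial (\<lambda>x. of_real ((norm x)\<^sup>2))"
  unfolding dot_square_norm[symmetric] inner_vec_def of_real_sum inner_real_def of_real_mult
  by (intro coordinate_polynomial_sum coordinate_polynomial.intros) simp

text \<open>
  The partial derivative is packaged with total differentiability, because the derivation of
  \<open>p * exp q\<close> below goes through \<^const>\<open>frechet_derivative\<close>, which is meaningful only where a
  derivative exists.
\<close>

lemma coordinate_polynomial_has_derivative:
  fixes p :: "real ^ 'd::finite \<Rightarrow> complex"
  assumes "coordinate_polynomial p"
  shows "\<exists>p'. coordinate_polynomial p' \<and> (\<forall>x. \<exists>D. (p has_derivative D) (at x) \<and> D (axis i 1) = p' x)"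
  using assms
proof induction
  case (const c)
  show ?case
    by (rule exI[of _ "\<lambda>x. 0"])
       (auto intro!: coordinate_polynomial.const exI[of _ "\<lambda>_. 0"])
next
  case (coordinate j)
  have "((\<lambda>x. complex_of_real (x $ j)) has_derivative (\<lambda>h. of_real (h $ j))) (at x)" for x :: "real ^ 'd"
    by (intro bounded_linear_imp_has_derivative bounded_linear_compose[OF bounded_linear_of_real]
        bounded_linear_vec_nth)
  then show ?case
    by (intro exI[of _ "\<lambda>x. of_real (axis i 1 $ j)"])
       (auto intro: coordinate_polynomial.const)
next
  case (add p q)
  then obtain p' q' where *: "coordinate_polynomial p'" "coordinate_polynomial q'"
    "\<And>x. \<exists>D. (p has_derivative D) (at x) \<and> D (axis i 1) = p' x"
    "\<And>x. \<exists>D. (q has_derivative D) (at x) \<and> D (axis i 1) = q' x"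
    by blast
  have "\<exists>D. ((\<lambda>x. p x + q x) has_derivative D) (at x) \<and> D (axis i 1) = p' x + q' x" for x
  proof -
    obtain D E where "(p has_derivative D) (at x)" "D (axis i 1) = p' x"
      "(q has_derivative E) (at x)" "E (axis i 1) = q' x"
      using *(3)[of x] *(4)[of x] by blast
    then show ?thesis
      by (intro exI[of _ "\<lambda>h. D h + E h"] conjI has_derivative_add) simp_all
  qed
  then show ?case
    using *(1,2) by (intro exI[of _ "\<lambda>x. p' x + q' x"]) (auto intro: coordinate_polynomial.add)
next
  case (mult p q)
  then obtain p' q' where *: "coordinate_polynomial p'" "coordinate_polynomial q'"
    "\<And>x. \<exists>D. (p has_derivative D) (at x) \<and> D (axis i 1) = p' x"
    "\<And>x. \<exists>D. (q has_derivative D) (at x) \<and> D (axis i 1) = q' x"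
    by blast
  have "\<exists>D. ((\<lambda>x. p x * q x) has_derivative D) (at x) \<and> D (axis i 1) = p x * q' x + p' x * q x" for x
  proof -
    obtain D E where "(p has_derivative D) (at x)" "D (axis i 1) = p' x"
      "(q has_derivative E) (at x)" "E (axis i 1) = q' x"
      using *(3)[of x] *(4)[of x] by blast
    then show ?thesis
      by (intro exI[of _ "\<lambda>h. p x * E h + D h * q x"] conjI has_derivative_mult) simp_all
  qed
  then show ?case
    using *(1,2) mult.hyps
    by (intro exI[of _ "\<lambda>x. p x * q' x + p' x * q x"]) (auto intro: coordinate_polynomial.intros)
qed

lemma has_derivative_exp_comp:
  fixes q :: "'a::real_normed_vector \<Rightarrow> 'b::{real_normed_field,banach}"
  assumes "(q has_derivative D) (at x)"
  shows "((\<lambda>x. exp (q x)) has_derivative (\<lambda>h. exp (q x) * D h)) (at x)"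
  using has_derivative_compose[OF assms DERIV_exp[unfolded has_field_derivative_def]] .

text \<open>
  Differentiation keeps the exponential factor: \<open>\<partial>\<^sub>i (r e\<^sup>q) = (\<partial>\<^sub>i r + r \<partial>\<^sub>i q) e\<^sup>q\<close>, and the bracket is
  again a polynomial.
\<close>

lemma iter_partial_polynomial_times_exp:
  fixes p q :: "real ^ 'd::finite \<Rightarrow> complex"
  assumes p: "coordinate_polynomial p" and q: "coordinate_polynomial q"
  shows "\<exists>r. coordinate_polynomial r \<and> iter_partial is (\<lambda>x. p x * exp (q x)) = (\<lambda>x. r x * exp (q x))"
proof (induction "is")
  case Nil
  then show ?case
    using p by auto
next
  case (Cons i "is")
  then obtain r where r: "coordinate_polynomial r"
    "iter_partial is (\<lambda>x. p x * exp (q x)) = (\<lambda>x. r x * exp (q x))"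
    by blast
  obtain r' q' where *: "coordinate_polynomial r'" "coordinate_polynomial q'"
    "\<And>x. \<exists>D. (r has_derivative D) (at x) \<and> D (axis i 1) = r' x"
    "\<And>x. \<exists>D. (q has_derivative D) (at x) \<and> D (axis i 1) = q' x"
    using coordinate_polynomial_has_derivative[OF r(1), of i] coordinate_polynomial_has_derivative[OF q, of i]
    by blast
  have "frechet_derivative (\<lambda>x. r x * exp (q x)) (at x) (axis i 1) = (r' x + r x * q' x) * exp (q x)" for x
  proof -
    obtain D E where D: "(r has_derivative D) (at x)" "D (axis i 1) = r' x"
      and E: "(q has_derivative E) (at x)" "E (axis i 1) = q' x"
      using *(3,4) by blast
    have "((\<lambda>x. r x * exp (q x)) has_derivative (\<lambda>h. r x * (exp (q x) * E h) + D h * exp (q x))) (at x)"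
      by (intro has_derivative_mult D(1) has_derivative_exp_comp[OF E(1)])
    then have "frechet_derivative (\<lambda>x. r x * exp (q x)) (at x) = (\<lambda>h. r x * (exp (q x) * E h) + D h * exp (q x))"
      by (rule frechet_derivative_at[symmetric])
    then show ?thesis
      using D(2) E(2) by (simp add: algebra_simps)
  qed
  then show ?case
    using r *(1,2)
    by (intro exI[of _ "\<lambda>x. r' x + r x * q' x"]) (auto intro: coordinate_polynomial.intros)
qed

lemma coordinate_polynomial_differentiable:
  assumes "coordinate_polynomial p"
  shows "p differentiable (at x)"
  using coordinate_polynomial_has_derivative[OF assms] by (meson differentiable_def)

text \<open>
  Comparing with \<open>exp (\<delta> |x|\<^sup>2)\<close> for every \<open>\<delta>\<close>, in place of powers of \<open>|x|\<close>, makes the induction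
  immediate: a product is handled by splitting \<open>\<delta>\<close> into halves.
\<close>

lemma coordinate_polynomial_gaussian_bound:
  fixes p :: "real ^ 'd::finite \<Rightarrow> complex"
  assumes "coordinate_polynomial p" and "\<delta> > 0"
  shows "\<exists>C. \<forall>x. cmod (p x) \<le> C * exp (\<delta> * (norm x)\<^sup>2)"
  using assms
proof (induction arbitrary: \<delta>)
  case (const c)
  then show ?case
    by (intro exI[of _ "cmod c"]) (auto simp: mult_le_cancel_left1)
next
  case (coordinate i)
  have "\<bar>x $ i\<bar> \<le> (1 + 1 / \<delta>) * exp (\<delta> * (norm x)\<^sup>2)" for x :: "real ^ 'd"
  proof -
    have "\<bar>x $ i\<bar> \<le> norm x"
      by (rule component_le_norm_cart)
    also have "norm x \<le> 1 + (norm x)\<^sup>2"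
      using zero_le_power2[of "norm x - 1"] zero_le_power2[of "norm x"]
      unfolding power2_diff power_one mult_1_right by linarith
    also have "\<dots> \<le> (1 + 1 / \<delta>) * (1 + \<delta> * (norm x)\<^sup>2)"
      using coordinate by (simp add: algebra_simps)
    also have "\<dots> \<le> (1 + 1 / \<delta>) * exp (\<delta> * (norm x)\<^sup>2)"
      using coordinate by (intro mult_left_mono exp_ge_add_one_self) auto
    finally show ?thesis .
  qed
  then show ?case
    by auto
next
  case (add p q)
  then obtain C D where *: "cmod (p x) \<le> C * exp (\<delta> * (norm x)\<^sup>2)" "cmod (q x) \<le> D * exp (\<delta> * (norm x)\<^sup>2)" for x
    by metis
  have "cmod (p x + q x) \<le> (C + D) * exp (\<delta> * (norm x)\<^sup>2)" for x
    using norm_triangle_ineq[of "p x" "q x"] *[of x] by (simp add: distrib_right)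
  then show ?case
    by blast
next
  case (mult p q)
  have "\<delta> / 2 > 0"
    using mult.prems by simp
  then obtain C D where *: "cmod (p x) \<le> C * exp (\<delta> / 2 * (norm x)\<^sup>2)" "cmod (q x) \<le> D * exp (\<delta> / 2 * (norm x)\<^sup>2)" for x
    using mult.IH by metis
  have "cmod (p x * q x) \<le> C * D * exp (\<delta> * (norm x)\<^sup>2)" for x
  proof -
    have "cmod (p x * q x) \<le> (C * exp (\<delta> / 2 * (norm x)\<^sup>2)) * (D * exp (\<delta> / 2 * (norm x)\<^sup>2))"
      unfolding norm_mult using *[of x] by (intro mult_mono) (auto intro: order_trans[OF norm_ge_zero])
    also have "\<dots> = C * D * (exp (\<delta> / 2 * (norm x)\<^sup>2) * exp (\<delta> / 2 * (norm x)\<^sup>2))"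
      by simp
    also have "\<dots> = C * D * exp (\<delta> * (norm x)\<^sup>2)"
      by (simp flip: exp_add)
    finally show ?thesis .
  qed
  then show ?case
    by blast
qed

text \<open>
  A monomial times an iterated partial derivative is again a polynomial times \<open>exp q\<close>, so the
  Schwartz bounds all reduce to the boundedness of such products: the polynomial grows at most like
  \<open>exp (\<delta> |x|\<^sup>2)\<close>, and this is compensated by the decay of \<open>exp q\<close>.
\<close>

lemma polynomial_times_exp_in_schwartz_space:
  fixes p q :: "real ^ 'd::finite \<Rightarrow> complex"
  assumes p: "coordinate_polynomial p" and q: "coordinate_polynomial q"
    and "\<delta> > 0" and decay: "\<And>x. Re (q x) \<le> - \<delta> * (norm x)\<^sup>2"
  shows "(\<lambda>x. p x * exp (q x)) \<in> schwartz_space"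
  unfolding schwartz_space_def smooth_fun_def mem_Collect_eq
proof (intro conjI allI)
  fix "is" :: "'d list" and x
  obtain r where r: "coordinate_polynomial r" "iter_partial is (\<lambda>x. p x * exp (q x)) = (\<lambda>x. r x * exp (q x))"
    using iter_partial_polynomial_times_exp[OF p q] by blast
  obtain D where "(q has_derivative D) (at x)"
    using coordinate_polynomial_differentiable[OF q] by (meson differentiable_def)
  then have "((\<lambda>x. exp (q x)) has_derivative (\<lambda>h. exp (q x) * D h)) (at x)"
    by (rule has_derivative_exp_comp)
  then show "iter_partial is (\<lambda>x. p x * exp (q x)) differentiable (at x)"
    unfolding r(2) using coordinate_polynomial_differentiable[OF r(1)]
    by (intro differentiable_mult) (auto simp: differentiable_def)
next
  fix \<alpha> :: "'d \<Rightarrow> nat" and "is" :: "'d list"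
  obtain r where r: "coordinate_polynomial r" "iter_partial is (\<lambda>x. p x * exp (q x)) = (\<lambda>x. r x * exp (q x))"
    using iter_partial_polynomial_times_exp[OF p q] by blast
  let ?m = "\<lambda>x::real ^ 'd. of_real (\<Prod>i\<in>UNIV. (x $ i) ^ \<alpha> i) * r x"
  have "coordinate_polynomial ?m"
    unfolding of_real_prod of_real_power
    by (intro coordinate_polynomial.intros coordinate_polynomial_prod coordinate_polynomial_power r) simp
  then obtain C where C: "cmod (?m x) \<le> C * exp (\<delta> * (norm x)\<^sup>2)" for x
    using coordinate_polynomial_gaussian_bound \<open>\<delta> > 0\<close> by blast
  have "cmod (?m x * exp (q x)) \<le> C" for x
  proof -
    have "cmod (?m x * exp (q x)) \<le> (C * exp (\<delta> * (norm x)\<^sup>2)) * exp (- \<delta> * (norm x)\<^sup>2)"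
      unfolding norm_mult[of "?m x"] using C[of x] decay[of x]
      by (intro mult_mono) (auto intro: order_trans[OF norm_ge_zero])
    then show ?thesis
      by (simp add: mult.assoc flip: exp_add)
  qed
  then show "\<exists>C. \<forall>x. cmod (of_real (\<Prod>i\<in>UNIV. (x $ i) ^ \<alpha> i) * iter_partial is (\<lambda>x. p x * exp (q x)) x) \<le> C"
    unfolding r(2) mult.assoc[symmetric] by blast
qed

section \<open>Integrating out the orthogonal complement of a direction\<close>

lemma integral_lborel_prod:
  fixes f :: "'a::euclidean_space \<Rightarrow> real \<Rightarrow> 'b::{real_normed_field,banach,second_countable_topology}"
  assumes f: "\<And>b. b \<in> Basis \<Longrightarrow> integrable lborel (f b)"
  shows "(LINT x|lborel. (\<Prod>b\<in>Basis. f b (x \<bullet> b))) = (\<Prod>b\<in>Basis. LINT s|lborel. f b s)"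
proof -
  interpret product_sigma_finite "\<lambda>_::'a. lborel :: real measure" ..
  have m[measurable]: "b \<in> Basis \<Longrightarrow> f b \<in> borel_measurable borel" for b
    using f[of b] by (simp add: integrable_iff_bounded)
  show ?thesis
    by (subst lborel_eq)
       (simp add: integral_distr borel_measurable_prod inner_sum_left product_integral_prod[OF _ f] inner_Basis
          if_distrib[of "\<lambda>c. _ * c"] sum.delta cong: prod.cong if_cong)
qed

lemma normal_density_via_precision:
  assumes "a > 0"
  shows "normal_density 0 (1 / sqrt (2 * a)) s = sqrt (a / pi) * exp (- a * s\<^sup>2)"
  using assms by (simp add: normal_density_def power_divide real_sqrt_divide field_simps)

lemma char_normal_distribution:
  assumes "\<sigma> > 0"
  shows "char (density lborel (normal_density 0 \<sigma>)) t = exp (- (\<sigma>\<^sup>2 * t\<^sup>2) / 2)"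
proof -
  have "char (density lborel (normal_density 0 \<sigma>)) t =
      (LINT s|lborel. normal_density 0 \<sigma> s *\<^sub>R iexp (t * s))"
    unfolding char_def by (simp add: integral_density)
  also have "\<dots> = (LINT s|lborel. std_normal_density s *\<^sub>R iexp (\<sigma> * t * s))"
    using assms
    by (subst lborel_integral_real_affine[where c=\<sigma> and t=0])
       (simp_all add: normal_density_def power_mult_distrib real_sqrt_mult ac_simps
          flip: Bochner_Integration.integral_scaleR_right)
  also have "\<dots> = char std_normal_distribution (\<sigma> * t)"
    unfolding char_def by (simp add: integral_density)
  finally show ?thesis
    by (simp add: char_std_normal_distribution power_mult_distrib)
qed

text \<open>
  Rotation invariance makes all one-dimensional marginals of the isotropic Gaussian equal. By
  uniqueness of characteristic functions it is enough that the exponents add up: the characteristic function at \<open>t\<close> factors over the basis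
  into \<open>exp (- \<sigma>\<^sup>2 t\<^sup>2 (u \<bullet> b)\<^sup>2 / 2)\<close>, and \<open>\<Sum>\<^sub>b (u \<bullet> b)\<^sup>2 = 1\<close>.
\<close>

lemma distr_inner_isotropic_gaussian:
  fixes u :: "'a::euclidean_space"
  assumes \<sigma>: "\<sigma> > 0" and u: "norm u = 1"
  shows "distr (density lborel (\<lambda>x. \<Prod>b\<in>Basis. normal_density 0 \<sigma> (x \<bullet> b))) borel (\<lambda>x. u \<bullet> x) =
    density lborel (normal_density 0 \<sigma>)"
proof (rule Levy_uniqueness)
  let ?\<gamma> = "\<lambda>x::'a. \<Prod>b\<in>Basis. normal_density 0 \<sigma> (x \<bullet> b)"
  have nn: "(\<integral>\<^sup>+s. ennreal (normal_density 0 \<sigma> s) \<partial>lborel) = 1"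
    using prob_space.emeasure_space_1[OF prob_space_normal_density[OF \<sigma>, of 0]]
    by (simp add: emeasure_density)
  have "emeasure (density lborel ?\<gamma>) (space (density lborel ?\<gamma>)) = 1"
    using nn_integral_lborel_prod[of "\<lambda>b::'a. normal_density 0 \<sigma>"] nn
    by (simp add: emeasure_density prod_ennreal)
  then interpret \<gamma>: prob_space "density lborel ?\<gamma>" ..
  show "real_distribution (distr (density lborel ?\<gamma>) borel (\<lambda>x. u \<bullet> x))"
    by (rule \<gamma>.real_distribution_distr) simp
  show "real_distribution (density lborel (normal_density 0 \<sigma>))"
    using prob_space_normal_density[OF \<sigma>, of 0]
    by (simp add: real_distribution_def real_distribution_axioms_def)
  show "char (distr (density lborel ?\<gamma>) borel (\<lambda>x. u \<bullet> x)) = char (density lborel (normal_density 0 \<sigma>))"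
  proof
    fix t
    have "char (distr (density lborel ?\<gamma>) borel (\<lambda>x. u \<bullet> x)) t =
        (LINT x|lborel. ?\<gamma> x *\<^sub>R iexp (t * (u \<bullet> x)))"
      unfolding char_def by (simp add: integral_distr integral_density prod_nonneg)
    also have "\<dots> = (LINT x|lborel. (\<Prod>b\<in>Basis. normal_density 0 \<sigma> (x \<bullet> b) *\<^sub>R iexp (t * (u \<bullet> b) * (x \<bullet> b))))"
    proof (rule Bochner_Integration.integral_cong)
      fix x :: 'a
      have "u \<bullet> x = (\<Sum>b\<in>Basis. (u \<bullet> b) * (x \<bullet> b))"
        by (rule euclidean_inner)
      then show "?\<gamma> x *\<^sub>R iexp (t * (u \<bullet> x)) =
          (\<Prod>b\<in>Basis. normal_density 0 \<sigma> (x \<bullet> b) *\<^sub>R iexp (t * (u \<bullet> b) * (x \<bullet> b)))"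
        by (simp add: scaleR_conv_of_real prod.distrib sum_distrib_left exp_sum ac_simps)
    qed simp
    also have "\<dots> = (\<Prod>b\<in>Basis. LINT s|lborel. normal_density 0 \<sigma> s *\<^sub>R iexp (t * (u \<bullet> b) * s))"
    proof (rule integral_lborel_prod)
      fix b :: 'a
      show "integrable lborel (\<lambda>s. normal_density 0 \<sigma> s *\<^sub>R iexp (t * (u \<bullet> b) * s))"
        by (rule Bochner_Integration.integrable_bound[OF integrable_normal_density[OF \<sigma>, of 0]])
           (auto simp flip: of_real_mult)
    qed
    also have "\<dots> = (\<Prod>b\<in>Basis. char (density lborel (normal_density 0 \<sigma>)) (t * (u \<bullet> b)))"
      unfolding char_def by (simp add: integral_density)
    also have "\<dots> = exp (\<Sum>b\<in>Basis. - (\<sigma>\<^sup>2 * (t * (u \<bullet> b))\<^sup>2) / 2)"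
      using \<sigma> by (simp add: char_normal_distribution exp_sum)
    also have "(\<Sum>b\<in>Basis. - (\<sigma>\<^sup>2 * (t * (u \<bullet> b))\<^sup>2) / 2) = - (\<sigma>\<^sup>2 * t\<^sup>2) / 2 * (\<Sum>b\<in>Basis. (u \<bullet> b) * (u \<bullet> b))"
      by (simp add: sum_distrib_left power_mult_distrib power2_eq_square sum_divide_distrib sum_negf ac_simps)
    also have "(\<Sum>b\<in>Basis. (u \<bullet> b) * (u \<bullet> b)) = 1"
      using u by (simp flip: euclidean_inner add: dot_square_norm)
    finally show "char (distr (density lborel ?\<gamma>) borel (\<lambda>x. u \<bullet> x)) t = char (density lborel (normal_density 0 \<sigma>)) t"
      using \<sigma> by (simp add: char_normal_distribution)
  qed
qed

text \<open>
  For \<open>a > 0\<close> and a unit vector \<open>u\<close>, \<open>|x|\<^sup>2 - (u \<bullet> x)\<^sup>2\<close> is the squared norm of the component of \<open>x\<close> orthogonal to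
  \<open>u\<close>, and the constant makes the integral over every hyperplane \<open>u \<bullet> x = s\<close> equal to \<open>1\<close>.
\<close>

definition transversal_gaussian :: "real \<Rightarrow> 'a::euclidean_space \<Rightarrow> 'a \<Rightarrow> real" where
  "transversal_gaussian a u x = sqrt (a / pi) ^ (DIM('a) - 1) * exp (- a * ((norm x)\<^sup>2 - (u \<bullet> x)\<^sup>2))"

lemma transversal_gaussian_pos: "a > 0 \<Longrightarrow> transversal_gaussian a u x > 0"
  by (simp add: transversal_gaussian_def)

lemma borel_measurable_transversal_gaussian [measurable]:
  "transversal_gaussian a u \<in> borel_measurable borel"
  unfolding transversal_gaussian_def by measurable

text \<open>
  Writing the weight as a normal density on the whole space divided by the normal density of
  \<open>u \<bullet> x\<close> makes the law of \<open>u \<bullet> x\<close> under the isotropic Gaussian available.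
\<close>

lemma transversal_gaussian_eq_quotient:
  fixes u :: "'a::euclidean_space"
  assumes a: "a > 0"
  defines "\<sigma> \<equiv> 1 / sqrt (2 * a)"
  shows "transversal_gaussian a u x =
    (\<Prod>b\<in>Basis. normal_density 0 \<sigma> (x \<bullet> b)) * (1 / normal_density 0 \<sigma> (u \<bullet> x))"
proof -
  have "(\<Prod>b\<in>Basis. normal_density 0 \<sigma> (x \<bullet> b)) =
      sqrt (a / pi) ^ DIM('a) * exp (\<Sum>b\<in>Basis. - a * (x \<bullet> b)\<^sup>2)"
    using a by (simp add: \<sigma>_def normal_density_via_precision prod.distrib exp_sum)
  also have "(\<Sum>b\<in>Basis. - a * (x \<bullet> b)\<^sup>2) = - a * (norm x)\<^sup>2"
    unfolding sum_distrib_left[symmetric] dot_square_norm[symmetric] euclidean_inner[of x x]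
    by (simp add: power2_eq_square)
  also have "sqrt (a / pi) ^ DIM('a) = sqrt (a / pi) * sqrt (a / pi) ^ (DIM('a) - 1)"
    by (metis DIM_positive power_eq_if less_irrefl)
  finally have "(\<Prod>b\<in>Basis. normal_density 0 \<sigma> (x \<bullet> b)) =
      sqrt (a / pi) * sqrt (a / pi) ^ (DIM('a) - 1) * exp (- a * (norm x)\<^sup>2)" .
  moreover have "exp (- a * ((norm x)\<^sup>2 - (u \<bullet> x)\<^sup>2)) = exp (- a * (norm x)\<^sup>2) / exp (- a * (u \<bullet> x)\<^sup>2)"
    by (simp add: right_diff_distrib flip: exp_diff)
  ultimately show ?thesis
    using a by (simp add: \<sigma>_def normal_density_via_precision[OF a] transversal_gaussian_def)
qed

text \<open>
  Integrating out \<open>u\<^sup>\<bottom>\<close> without rotating \<open>u\<close> to a coordinate axis: the map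
  \<open>x \<mapsto> u \<bullet> x\<close> sends the isotropic Gaussian to the normal distribution on the line, and the
  denominator of the quotient, which depends on \<open>u \<bullet> x\<close> only, cancels the normal density there.
\<close>

lemma distr_inner_transversal_gaussian:
  fixes u :: "'a::euclidean_space"
  assumes a: "a > 0" and u: "norm u = 1"
  shows "distr (density lborel (transversal_gaussian a u)) borel (\<lambda>x. u \<bullet> x) = lborel"
proof -
  define \<sigma> where "\<sigma> = 1 / sqrt (2 * a)"
  have \<sigma>: "\<sigma> > 0"
    using a by (simp add: \<sigma>_def)
  let ?\<gamma> = "\<lambda>x::'a. \<Prod>b\<in>Basis. normal_density 0 \<sigma> (x \<bullet> b)"
  let ?r = "\<lambda>s. 1 / normal_density 0 \<sigma> s"
  have pos: "normal_density 0 \<sigma> s > 0" for s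
    by (rule normal_density_pos[OF \<sigma>])
  have "density lborel (transversal_gaussian a u) =
      density (density lborel ?\<gamma>) (\<lambda>x. ?r (u \<bullet> x))"
    using pos[THEN less_imp_le]
    by (subst density_density_eq)
       (simp_all add: transversal_gaussian_eq_quotient[OF a] \<sigma>_def[symmetric] prod_nonneg
          del: times_divide_eq_right flip: ennreal_mult)
  then have "distr (density lborel (transversal_gaussian a u)) borel (\<lambda>x. u \<bullet> x) =
      density (distr (density lborel ?\<gamma>) borel (\<lambda>x. u \<bullet> x)) ?r"
    by (simp add: density_distr)
  also have "\<dots> = density lborel (\<lambda>s. ennreal (normal_density 0 \<sigma> s) * ennreal (?r s))"
    by (simp add: distr_inner_isotropic_gaussian[OF \<sigma> u] density_density_eq)
  also have "\<dots> = lborel"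
    using pos[THEN less_imp_neq] by (simp flip: ennreal_mult' add: density_1)
  finally show ?thesis .
qed

text \<open>
  Preimages of null sets under \<open>x \<mapsto> u \<bullet> x\<close> are null, because Lebesgue measure with a positive
  weight is mapped to Lebesgue measure. Hence composing with \<open>u \<bullet> x\<close> respects equality
  almost everywhere.
\<close>

lemma AE_inner:
  fixes u :: "'a::euclidean_space"
  assumes u: "norm u = 1" and P: "AE s in lborel. P s"
  shows "AE x in lborel. P (u \<bullet> x)"
proof -
  have "AE s in distr (density lborel (transversal_gaussian 1 u)) borel (\<lambda>x. u \<bullet> x). P s"
    using P by (simp only: distr_inner_transversal_gaussian[OF zero_less_one u])
  then have "AE x in density lborel (transversal_gaussian 1 u). P (u \<bullet> x)"
    by (rule AE_distrD[rotated]) simp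
  then show ?thesis
    by (simp add: AE_density transversal_gaussian_pos)
qed

lemma integral_ridge:
  fixes u :: "'a::euclidean_space" and B :: "real \<Rightarrow> 'b::{banach,second_countable_topology}"
  assumes a: "a > 0" and u: "norm u = 1" and [measurable]: "B \<in> borel_measurable borel"
  shows "(LINT x|lborel. transversal_gaussian a u x *\<^sub>R B (u \<bullet> x)) = (LINT s|lborel. B s)"
  using transversal_gaussian_pos[OF a, of u, THEN less_imp_le]
  by (subst distr_inner_transversal_gaussian[OF a u, symmetric])
     (simp add: integral_distr integral_density)

text \<open>
  The source of the small \<open>L\<^sup>2\<close> norm: squaring doubles the exponent, and the renormalisation leaves a
  power of \<open>a\<close> for the \<open>d - 1\<close> transversal dimensions.
\<close>

lemma transversal_gaussian_square:
  fixes u :: "'a::euclidean_space"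
  assumes "a > 0"
  shows "(transversal_gaussian a u x)\<^sup>2 =
    sqrt (a / (2 * pi)) ^ (DIM('a) - 1) * transversal_gaussian (2 * a) u x"
proof -
  have "(sqrt (a / pi))\<^sup>2 = sqrt (a / (2 * pi)) * sqrt (2 * a / pi)"
    using assms by (simp add: real_sqrt_mult real_sqrt_divide power_divide)
  then have "(sqrt (a / pi) ^ n)\<^sup>2 = sqrt (a / (2 * pi)) ^ n * sqrt (2 * a / pi) ^ n" for n
    by (metis power_mult_distrib power_commuting_commutes power_mult mult.commute)
  then show ?thesis
    by (simp add: transversal_gaussian_def power_mult_distrib exp_double[symmetric] algebra_simps)
qed

section \<open>Uniqueness of the Fourier transform\<close>

text \<open>
  If the Fourier transform of \<open>f\<close> vanishes, then the positive and the negative part of \<open>f\<close> have the same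
  Fourier transform. The value at \<open>0\<close> shows that they have the same integral \<open>I\<close>. If \<open>I = 0\<close>, both
  are null; otherwise division by \<open>I\<close> makes them probability densities with equal characteristic
  functions, and these determine the density.
\<close>

lemma fourier_uniqueness_real:
  fixes f :: "real \<Rightarrow> real"
  assumes f: "integrable lborel f"
    and zero: "\<And>\<xi>. (LINT s|lborel. f s *\<^sub>R iexp (\<xi> * s)) = 0"
  shows "AE s in lborel. f s = 0"
proof -
  define p where "p = (\<lambda>s. max 0 (f s))"
  define n where "n = (\<lambda>s. max 0 (- f s))"
  have [measurable]: "f \<in> borel_measurable borel"
    using f by (simp add: integrable_iff_bounded)
  have [measurable]: "p \<in> borel_measurable borel" "n \<in> borel_measurable borel"
    unfolding p_def n_def by measurable
  have nn: "p s \<ge> 0" "n s \<ge> 0" and f_eq: "f s = p s - n s" for s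
    by (auto simp: p_def n_def)
  have int: "integrable lborel p" "integrable lborel n"
    unfolding p_def n_def using f by auto
  have iexp_int: "integrable lborel (\<lambda>s. h s *\<^sub>R iexp (\<xi> * s))" if "integrable lborel h" for h :: "real \<Rightarrow> real" and \<xi>
    using that by (rule Bochner_Integration.integrable_bound)
      (use that in \<open>auto simp flip: of_real_mult simp: integrable_iff_bounded\<close>)
  have same: "(LINT s|lborel. p s *\<^sub>R iexp (\<xi> * s)) = (LINT s|lborel. n s *\<^sub>R iexp (\<xi> * s))" for \<xi>
    using zero[of \<xi>] iexp_int[OF int(1), of \<xi>] iexp_int[OF int(2), of \<xi>]
    by (simp add: f_eq scaleR_left_diff_distrib)
  define I where "I = (LINT s|lborel. p s)"
  have I: "(LINT s|lborel. p s) = I" "(LINT s|lborel. n s) = I"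
    using same[of 0] by (simp_all add: I_def scaleR_conv_of_real of_real_eq_iff[where 'a=complex, symmetric] del: of_real_eq_iff)
  show ?thesis
  proof (cases "I = 0")
    case True
    then have "AE s in lborel. p s = 0" "AE s in lborel. n s = 0"
      using integral_nonneg_eq_0_iff_AE[of lborel p] integral_nonneg_eq_0_iff_AE[of lborel n] int nn I by auto
    then show ?thesis
      by eventually_elim (simp add: f_eq)
  next
    case False
    moreover have "I \<ge> 0"
      unfolding I_def using nn by simp
    ultimately have "I > 0"
      by simp
    have distribution: "real_distribution (density lborel (\<lambda>s. h s / I))"
      if [measurable]: "integrable lborel h" and h: "\<And>s. h s \<ge> 0" "(LINT s|lborel. h s) = I" for h :: "real \<Rightarrow> real"
    proof -
      have "(\<integral>\<^sup>+s. ennreal (h s / I) \<partial>lborel) = ennreal (LINT s|lborel. h s / I)"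
        using that \<open>I > 0\<close> by (intro nn_integral_eq_integral) auto
      then have "emeasure (density lborel (\<lambda>s. h s / I)) (space (density lborel (\<lambda>s. h s / I))) = 1"
        using that \<open>I > 0\<close> by (simp add: emeasure_density)
      then show ?thesis
        by (simp add: real_distribution_def real_distribution_axioms_def prob_spaceI)
    qed
    have char_eq: "char (density lborel (\<lambda>s. h s / I)) \<xi> = (LINT s|lborel. h s *\<^sub>R iexp (\<xi> * s)) / I"
      if [measurable]: "h \<in> borel_measurable borel" and "\<And>s. h s \<ge> 0" for h :: "real \<Rightarrow> real" and \<xi>
      using that \<open>I > 0\<close> unfolding char_def
      by (simp add: integral_density scaleR_conv_of_real flip: integral_divide_zero)
    have "density lborel (\<lambda>s. p s / I) = density lborel (\<lambda>s. n s / I)"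
      by (rule Levy_uniqueness)
         (auto intro!: distribution int nn I ext simp only: char_eq[OF _ nn(1)] char_eq[OF _ nn(2)] same
            \<open>p \<in> borel_measurable borel\<close> \<open>n \<in> borel_measurable borel\<close>)
    then have "AE s in lborel. ennreal (p s / I) = ennreal (n s / I)"
      by (intro sigma_finite_measure.density_unique[OF sigma_finite_lborel]) auto
    then show ?thesis
      by eventually_elim (use nn \<open>I > 0\<close> in \<open>simp add: f_eq\<close>)
  qed
qed

text \<open>
  The conjugate of \<open>f\<close> also has vanishing Fourier transform, its value at \<open>\<xi>\<close> being the conjugate of
  that of \<open>f\<close> at \<open>- \<xi>\<close>. So the real and imaginary parts of \<open>f\<close> can be treated separately.
\<close>

lemma fourier_uniqueness:
  fixes f :: "real \<Rightarrow> complex"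
  assumes f: "integrable lborel f"
    and zero: "\<And>\<xi>. (LINT s|lborel. f s * iexp (\<xi> * s)) = 0"
  shows "AE s in lborel. f s = 0"
proof -
  have bounded: "integrable lborel (\<lambda>s. h s * iexp (\<xi> * s))" if "integrable lborel h" for h :: "real \<Rightarrow> complex" and \<xi>
    using that by (rule Bochner_Integration.integrable_bound)
      (use that in \<open>auto simp flip: of_real_mult simp: integrable_iff_bounded norm_mult\<close>)
  have cnj_zero: "(LINT s|lborel. cnj (f s) * iexp (\<xi> * s)) = 0" for \<xi>
  proof -
    have "(LINT s|lborel. cnj (f s) * iexp (\<xi> * s)) = (LINT s|lborel. cnj (f s * iexp (- \<xi> * s)))"
      by (simp add: exp_cnj)
    also have "\<dots> = cnj (LINT s|lborel. f s * iexp (- \<xi> * s))"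
      by (rule Bochner_Integration.integral_cnj)
    finally show ?thesis
      by (simp only: zero complex_cnj_zero)
  qed
  have cf: "integrable lborel (\<lambda>s. cnj (f s))"
    using f by simp
  have "(LINT s|lborel. Re (f s) *\<^sub>R iexp (\<xi> * s)) = 0" for \<xi>
  proof -
    have "(LINT s|lborel. Re (f s) *\<^sub>R iexp (\<xi> * s)) =
        (LINT s|lborel. (f s * iexp (\<xi> * s) + cnj (f s) * iexp (\<xi> * s)) / 2)"
      by (simp add: complex_add_cnj scaleR_conv_of_real flip: distrib_right)
    then show ?thesis
      using bounded[OF f, of \<xi>] bounded[OF cf, of \<xi>] zero[of \<xi>] cnj_zero[of \<xi>] by simp
  qed
  then have re: "AE s in lborel. Re (f s) = 0"
    using f by (intro fourier_uniqueness_real) auto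
  have im_eq: "complex_of_real (Im z) * w = (z * w - cnj z * w) / (2 * \<i>)" for z w
  proof -
    have "z * w - cnj z * w = 2 * \<i> * (complex_of_real (Im z) * w)"
      by (simp add: complex_eq_iff)
    then show ?thesis
      by simp
  qed
  have "(LINT s|lborel. Im (f s) *\<^sub>R iexp (\<xi> * s)) = 0" for \<xi>
  proof -
    have "(LINT s|lborel. Im (f s) *\<^sub>R iexp (\<xi> * s)) =
        (LINT s|lborel. (f s * iexp (\<xi> * s) - cnj (f s) * iexp (\<xi> * s)) / (2 * \<i>))"
      by (simp add: im_eq scaleR_conv_of_real)
    then show ?thesis
      using bounded[OF f, of \<xi>] bounded[OF cf, of \<xi>] zero[of \<xi>] cnj_zero[of \<xi>] by simp
  qed
  then have "AE s in lborel. Im (f s) = 0"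
    using f by (intro fourier_uniqueness_real) auto
  with re show ?thesis
    by eventually_elim (simp add: complex_eq_iff)
qed

lemma borel_measurable_cnj [measurable]: "cnj \<in> borel_measurable borel"
  by (intro borel_measurable_continuous_onI continuous_intros)

lemma integrable_gaussian:
  assumes "a > 0"
  shows "integrable lborel (\<lambda>s::real. exp (- a * s\<^sup>2))"
proof -
  have "integrable lborel (\<lambda>s. normal_density 0 (1 / sqrt (2 * a)) s / sqrt (a / pi))"
    using assms by (intro integrable_divide integrable_normal_density) simp
  then show ?thesis
    using assms by (simp add: normal_density_via_precision)
qed

text \<open>
  The Gaussian factor makes the square integrable \<open>h\<close> integrable, so that uniqueness of the Fourier
  transform applies to the product; as the Gaussian has no zeros, the product is null only if \<open>h\<close> is.
\<close>

lemma ex_nonzero_gaussian_fourier_coefficient: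
  fixes h :: "real \<Rightarrow> complex"
  assumes [measurable]: "h \<in> borel_measurable borel"
    and h2: "integrable lborel (\<lambda>s. (cmod (h s))\<^sup>2)"
    and nz: "\<not> (AE s in lborel. h s = 0)"
  obtains \<xi> where "(LINT s|lborel. exp (- of_real (s\<^sup>2)) * iexp (\<xi> * s) * cnj (h s)) \<noteq> 0"
proof (rule ccontr)
  let ?f = "\<lambda>s. exp (- complex_of_real (s\<^sup>2)) * cnj (h s)"
  assume "\<not> thesis"
  with that have "(LINT s|lborel. exp (- of_real (s\<^sup>2)) * iexp (\<xi> * s) * cnj (h s)) = 0" for \<xi>
    by blast
  then have zero: "(LINT s|lborel. ?f s * iexp (\<xi> * s)) = 0" for \<xi>
    by (simp add: mult.assoc mult.commute[of "cnj _"])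
  have "integrable lborel ?f"
  proof (rule Bochner_Integration.integrable_bound)
    show "integrable lborel (\<lambda>s. exp (- 2 * s\<^sup>2) + (cmod (h s))\<^sup>2)"
      by (intro Bochner_Integration.integrable_add integrable_gaussian h2) simp
    have "norm (?f s) \<le> exp (- 2 * s\<^sup>2) + (cmod (h s))\<^sup>2" for s
    proof -
      have "exp (- s\<^sup>2) * cmod (h s) \<le> (exp (- s\<^sup>2))\<^sup>2 + (cmod (h s))\<^sup>2"
        using sum_squares_bound[of "exp (- s\<^sup>2)" "cmod (h s)"]
          mult_nonneg_nonneg[OF exp_ge_zero norm_ge_zero, of "- s\<^sup>2" "h s"] by linarith
      then show ?thesis
        by (simp add: norm_mult norm_exp_eq_Re flip: exp_double)
    qed
    then show "AE s in lborel. norm (?f s) \<le> norm (exp (- 2 * s\<^sup>2) + (cmod (h s))\<^sup>2)"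
      by (auto intro: order_trans[OF _ abs_ge_self])
  qed measurable
  then have "AE s in lborel. ?f s = 0"
    using zero by (rule fourier_uniqueness)
  with nz show False
    by simp
qed

section \<open>Borel representatives of the window\<close>

lemma borel_representative:
  fixes g :: "'a::euclidean_space \<Rightarrow> complex"
  assumes "g \<in> borel_measurable lebesgue"
  obtains h where "h \<in> borel_measurable borel" "AE x in lborel. g x = h x"
proof -
  obtain p where p: "p \<in> borel_measurable lborel" "AE x in lborel. Re (g x) = p x"
    using completion_ex_borel_measurable_real[of "\<lambda>x. Re (g x)" lborel] assms by auto
  obtain q where q: "q \<in> borel_measurable lborel" "AE x in lborel. Im (g x) = q x"
    using completion_ex_borel_measurable_real[of "\<lambda>x. Im (g x)" lborel] assms by auto
  show thesis
  proof
    show "(\<lambda>x. Complex (p x) (q x)) \<in> borel_measurable borel"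
      using p(1) q(1) by (subst borel_measurable_complex_iff) simp
    show "AE x in lborel. g x = Complex (p x) (q x)"
      using p(2) q(2) by eventually_elim (simp add: complex_eq_iff)
  qed
qed

text \<open>
  Modulation does not change the modulus, and translation preserves Lebesgue measure, so square
  integrability and not being null pass from the window to its time-frequency shift. A Borel
  representative is needed because composing a merely Lebesgue measurable function with a map need
  not preserve measurability.
\<close>

lemma gabor_borel_representative:
  assumes g: "square_integrable g" and nz: "\<not> (AE s in lebesgue. g s = 0)"
  obtains h where "h \<in> borel_measurable borel" "integrable lborel (\<lambda>s. (cmod (h s))\<^sup>2)"
    "\<not> (AE s in lborel. h s = 0)" "AE s in lborel. gabor g m t s = h s"
proof -
  have translate: "AE s in lborel. P (c + s)" if "AE s in lborel. P s" for P and c :: real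
  proof (rule AE_distrD[of "(+) c" lborel borel P])
    show "AE s in distr lborel borel ((+) c). P s"
      using that by (simp only: lborel_distr_plus)
  qed simp
  obtain k where k[measurable]: "k \<in> borel_measurable borel" and gk: "AE s in lborel. g s = k s"
    using g borel_representative unfolding square_integrable_def by blast
  define h where "h = gabor k m t"
  have cmod_h: "cmod (h s) = cmod (k (- t + s))" for s
    by (simp add: h_def gabor_def norm_mult norm_exp_eq_Re)
  show thesis
  proof
    show "h \<in> borel_measurable borel"
      unfolding h_def gabor_def by measurable
    have "integrable lebesgue (\<lambda>s. (cmod (k s))\<^sup>2)"
      using g gk unfolding square_integrable_def
      by (elim conjE integrable_cong_AE_imp)
         (auto simp: AE_completion_iff measurable_completion elim!: eventually_mono)
    then have "integrable lborel (\<lambda>s. (cmod (k s))\<^sup>2)"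
      by (simp add: integrable_completion)
    from lborel_integrable_real_affine[OF this, of 1 "- t"]
    show "integrable lborel (\<lambda>s. (cmod (h s))\<^sup>2)"
      by (simp add: cmod_h)
    show "\<not> (AE s in lborel. h s = 0)"
    proof
      assume "AE s in lborel. h s = 0"
      then have "AE s in lborel. k (- t + s) = 0"
        by eventually_elim (use cmod_h in \<open>metis norm_eq_zero\<close>)
      from translate[OF this, of t] have "AE s in lborel. k s = 0"
        by simp
      with gk have "AE s in lborel. g s = 0"
        by eventually_elim simp
      with nz show False
        by (simp add: AE_completion_iff)
    qed
    show "AE s in lborel. gabor g m t s = h s"
      using translate[OF gk, of "- t"] by eventually_elim (simp add: h_def gabor_def)
  qed
qed

section \<open>Wave packets spread out along a hyperplane\<close>

definition wave_packet :: "real \<Rightarrow> real \<Rightarrow> 'a::euclidean_space \<Rightarrow> 'a \<Rightarrow> complex" where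
  "wave_packet \<xi> a u x =
    exp (- of_real ((u \<bullet> x)\<^sup>2)) * iexp (\<xi> * (u \<bullet> x)) * of_real (transversal_gaussian a u x)"

text \<open>
  With \<open>s = u \<bullet> x\<close> the real part of the exponent is \<open>- s\<^sup>2 - a (|x|\<^sup>2 - s\<^sup>2) = (a - 1) s\<^sup>2 - a |x|\<^sup>2\<close>, so
  for \<open>a \<le> 1\<close> it is at most \<open>- a |x|\<^sup>2\<close>.
\<close>

lemma wave_packet_in_schwartz_space:
  fixes u :: "real ^ 'd::finite"
  assumes a: "0 < a" "a \<le> 1"
  shows "(\<lambda>x. c * wave_packet \<xi> a u x) \<in> schwartz_space"
proof -
  define K where "K = c * complex_of_real (sqrt (a / pi) ^ (DIM(real ^ 'd) - 1))"
  define q where "q = (\<lambda>x::real ^ 'd. of_real (a - 1) * of_real (u \<bullet> x) ^ 2 +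
    (\<i> * of_real \<xi>) * of_real (u \<bullet> x) + of_real (- a) * of_real ((norm x)\<^sup>2))"
  have "(\<lambda>x. K * exp (q x)) \<in> schwartz_space"
  proof (rule polynomial_times_exp_in_schwartz_space)
    show "coordinate_polynomial q"
      unfolding q_def
      by (intro coordinate_polynomial.intros coordinate_polynomial_power coordinate_polynomial_inner
          coordinate_polynomial_norm_square)
    fix x
    have "Re (q x) = (a - 1) * (u \<bullet> x)\<^sup>2 - a * (norm x)\<^sup>2"
      by (simp add: q_def flip: of_real_power)
    also have "\<dots> \<le> - a * (norm x)\<^sup>2"
      using a by (simp add: mult_nonpos_nonneg)
    finally show "Re (q x) \<le> - a * (norm x)\<^sup>2" .
  qed (use a in \<open>auto intro: coordinate_polynomial.const\<close>)
  also have "(\<lambda>x. K * exp (q x)) = (\<lambda>x. c * wave_packet \<xi> a u x)"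
  proof
    fix x
    have "exp (q x) = exp (- of_real ((u \<bullet> x)\<^sup>2)) * iexp (\<xi> * (u \<bullet> x)) *
        of_real (exp (- a * ((norm x)\<^sup>2 - (u \<bullet> x)\<^sup>2)))"
      unfolding exp_of_real[symmetric] exp_add[symmetric]
      by (simp add: q_def algebra_simps)
    then show "K * exp (q x) = c * wave_packet \<xi> a u x"
      by (simp add: wave_packet_def transversal_gaussian_def K_def)
  qed
  finally show ?thesis .
qed

lemma borel_measurable_wave_packet [measurable]: "wave_packet \<xi> a u \<in> borel_measurable borel"
  unfolding wave_packet_def by measurable

lemma L2norm_wave_packet:
  fixes u :: "'a::euclidean_space"
  assumes a: "a > 0" and u: "norm u = 1"
  shows "L2norm (\<lambda>x. c * wave_packet \<xi> a u x) =
    cmod c * sqrt (sqrt (a / (2 * pi)) ^ (DIM('a) - 1) * (LINT s|lborel. exp (- 2 * s\<^sup>2)))"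
proof -
  have "(cmod (c * wave_packet \<xi> a u x))\<^sup>2 =
      ((cmod c)\<^sup>2 * sqrt (a / (2 * pi)) ^ (DIM('a) - 1)) *
      (transversal_gaussian (2 * a) u x *\<^sub>R exp (- 2 * (u \<bullet> x)\<^sup>2))" for x
  proof -
    have "(exp (- (u \<bullet> x)\<^sup>2))\<^sup>2 = exp (- 2 * (u \<bullet> x)\<^sup>2)"
      by (simp flip: exp_double)
    then show ?thesis
      by (simp add: wave_packet_def norm_mult norm_exp_eq_Re power_mult_distrib
          transversal_gaussian_square[OF a])
  qed
  then have "(LINT x|lborel. (cmod (c * wave_packet \<xi> a u x))\<^sup>2) =
      (cmod c)\<^sup>2 * sqrt (a / (2 * pi)) ^ (DIM('a) - 1) * (LINT s|lborel. exp (- 2 * s\<^sup>2))"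
    using integral_ridge[of "2 * a" u "\<lambda>s. exp (- 2 * s\<^sup>2)"] a u by simp
  moreover have "(LINT x|lebesgue. (cmod (c * wave_packet \<xi> a u x))\<^sup>2) =
      (LINT x|lborel. (cmod (c * wave_packet \<xi> a u x))\<^sup>2)"
    by (rule integral_completion) measurable
  ultimately show ?thesis
    by (simp add: L2norm_def real_sqrt_mult mult.assoc)
qed

lemma pairing_wave_packet:
  fixes u :: "'a::euclidean_space"
  assumes a: "a > 0" and u: "norm u = 1"
    and h[measurable]: "h \<in> borel_measurable borel" and kh: "AE s in lborel. k s = h s"
  shows "pairing (\<lambda>x. c * wave_packet \<xi> a u x) (\<lambda>x. k (u \<bullet> x)) =
    c * (LINT s|lborel. exp (- of_real (s\<^sup>2)) * iexp (\<xi> * s) * cnj (h s))"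
proof -
  let ?F = "\<lambda>x. c * wave_packet \<xi> a u x * cnj (h (u \<bullet> x))"
  have F: "?F \<in> borel_measurable lborel"
    by measurable
  have eq: "AE x in lebesgue. c * wave_packet \<xi> a u x * cnj (k (u \<bullet> x)) = ?F x"
    using AE_inner[OF u kh] unfolding AE_completion_iff by eventually_elim simp
  have "(LINT x|lebesgue. c * wave_packet \<xi> a u x * cnj (k (u \<bullet> x))) = (LINT x|lebesgue. ?F x)"
  proof (rule integral_cong_AE)
    show "?F \<in> borel_measurable lebesgue"
      using F by (rule measurable_completion)
    then show "(\<lambda>x. c * wave_packet \<xi> a u x * cnj (k (u \<bullet> x))) \<in> borel_measurable lebesgue"
      by (rule borel_measurable_AE) (use eq in \<open>simp only: eq_commute\<close>)
  qed (rule eq)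
  also have "\<dots> = (LINT x|lborel. ?F x)"
    using F by (rule integral_completion)
  also have "\<dots> = (LINT x|lborel. c * (transversal_gaussian a u x *\<^sub>R
      (exp (- of_real ((u \<bullet> x)\<^sup>2)) * iexp (\<xi> * (u \<bullet> x)) * cnj (h (u \<bullet> x)))))"
    by (simp add: wave_packet_def scaleR_conv_of_real ac_simps)
  also have "\<dots> = c * (LINT s|lborel. exp (- of_real (s\<^sup>2)) * iexp (\<xi> * s) * cnj (h s))"
    using integral_ridge[OF a u, of "\<lambda>s. exp (- of_real (s\<^sup>2)) * iexp (\<xi> * s) * cnj (h s)"]
    by (simp del: mult_scaleR_right)
  finally show ?thesis
    unfolding pairing_def .
qed

lemma gabor_sum_ge_term:
  assumes "l \<in> \<Lambda>"
  shows "ennreal ((cmod (pairing f (dir_gabor g l)))\<^sup>2) \<le> gabor_sum g \<Lambda> f"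
proof -
  have "infsum (\<lambda>l. ennreal ((cmod (pairing f (dir_gabor g l)))\<^sup>2)) {l} \<le> gabor_sum g \<Lambda> f"
    unfolding gabor_sum_def
    by (rule infsum_mono_neutral) (use assms in \<open>auto intro: nonneg_summable_on_complete\<close>)
  then show ?thesis
    by simp
qed

section \<open>Failure of the Bessel property\<close>

theorem theorem3p3:
  fixes g :: "real \<Rightarrow> complex"
    and \<Lambda> :: "(real \<times> real \<times> (real ^ 'd::finite)) set"
  assumes "CARD('d) \<ge> 2"
    and "square_integrable g"
    and "\<not> (AE s in lebesgue. g s = 0)"
    and "\<Lambda> \<subseteq> UNIV \<times> UNIV \<times> sphere 0 1"
    and "discrete \<Lambda>"
    and "\<Lambda> \<noteq> {}"
  shows "(\<exists>\<phi> :: nat \<Rightarrow> real ^ 'd \<Rightarrow> complex.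
            (\<forall>n. \<phi> n \<in> schwartz_space) \<and>
            (\<lambda>n. L2norm (\<phi> n)) \<longlonglongrightarrow> 0 \<and>
            (\<forall>n. gabor_sum g \<Lambda> (\<phi> n) \<ge> 1)) \<and>
         (\<forall>V :: (real ^ 'd \<Rightarrow> complex) set.
            L2_function_space V \<and> schwartz_space \<subseteq> V \<longrightarrow>
              \<not> is_frame g \<Lambda> V \<and> \<not> is_bessel g \<Lambda> V)"
proof -
  obtain m t and u :: "real ^ 'd" where l: "(m, t, u) \<in> \<Lambda>"
    using \<open>\<Lambda> \<noteq> {}\<close> by (metis ex_in_conv prod_cases3)
  then have u: "norm u = 1"
    using assms(4) by auto
  obtain h where h: "h \<in> borel_measurable borel" "integrable lborel (\<lambda>s. (cmod (h s))\<^sup>2)"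
    "\<not> (AE s in lborel. h s = 0)" "AE s in lborel. gabor g m t s = h s"
    using gabor_borel_representative[OF assms(2,3)] .
  obtain \<xi> where \<xi>: "(LINT s|lborel. exp (- of_real (s\<^sup>2)) * iexp (\<xi> * s) * cnj (h s)) \<noteq> 0"
    using ex_nonzero_gaussian_fourier_coefficient[OF h(1-3)] .
  \<comment> \<open>The pairing of a wave packet does not depend on its width, so one constant normalises all of them to pairing \<open>1\<close>.\<close>
  define c where "c = 1 / (LINT s|lborel. exp (- of_real (s\<^sup>2)) * iexp (\<xi> * s) * cnj (h s))"
  define a where "a = (\<lambda>n::nat. inverse (real (Suc n)))"
  have a: "0 < a n" "a n \<le> 1" for n
    by (auto simp: a_def field_simps)
  have a_lim: "a \<longlonglongrightarrow> 0"
    unfolding a_def by (rule LIMSEQ_inverse_real_of_nat)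
  define \<phi> where "\<phi> = (\<lambda>n x. c * wave_packet \<xi> (a n) u x)"
  have schwartz: "\<phi> n \<in> schwartz_space" for n
    unfolding \<phi>_def by (rule wave_packet_in_schwartz_space[OF a])
  have "(\<lambda>n. cmod c * sqrt (sqrt (a n / (2 * pi)) ^ (DIM(real ^ 'd) - 1) * (LINT s|lborel. exp (- 2 * s\<^sup>2))))
      \<longlonglongrightarrow> cmod c * sqrt (sqrt (0 / (2 * pi)) ^ (DIM(real ^ 'd) - 1) * (LINT s|lborel. exp (- 2 * s\<^sup>2)))"
    by (intro tendsto_intros a_lim) simp
  \<comment> \<open>With at least one transversal dimension the power of \<open>a n\<close> in the norm is positive.\<close>
  moreover have "(0::real) ^ (DIM(real ^ 'd) - 1) = 0"
    using assms(1) by simp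
  ultimately have lim: "(\<lambda>n. L2norm (\<phi> n)) \<longlonglongrightarrow> 0"
    unfolding \<phi>_def L2norm_wave_packet[OF a(1) u] div_0 real_sqrt_zero by (simp only:) simp
  have "pairing (\<phi> n) (dir_gabor g (m, t, u)) =
      c * (LINT s|lborel. exp (- of_real (s\<^sup>2)) * iexp (\<xi> * s) * cnj (h s))" for n
    unfolding \<phi>_def dir_gabor_def prod.case by (rule pairing_wave_packet[OF a(1) u h(1,4)])
  then have "pairing (\<phi> n) (dir_gabor g (m, t, u)) = 1" for n
    unfolding c_def using \<xi> by (simp only: divide_self_if nonzero_eq_divide_eq times_divide_eq_left mult_1_left if_False)
  then have ge: "1 \<le> gabor_sum g \<Lambda> (\<phi> n)" for n
    using gabor_sum_ge_term[OF l, of "\<phi> n" g] by simp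
  have "\<not> is_bessel g \<Lambda> V" if V: "schwartz_space \<subseteq> V" for V
  proof
    assume "is_bessel g \<Lambda> V"
    then obtain B where B: "\<And>f. f \<in> V \<Longrightarrow> gabor_sum g \<Lambda> f \<le> ennreal (B * (L2norm f)\<^sup>2)"
      unfolding is_bessel_def by blast
    have "1 \<le> B * (L2norm (\<phi> n))\<^sup>2" for n
      using order_trans[OF ge[of n] B] V schwartz[of n] by auto
    moreover have "(\<lambda>n. B * (L2norm (\<phi> n))\<^sup>2) \<longlonglongrightarrow> B * 0\<^sup>2"
      by (intro tendsto_intros lim)
    ultimately have "1 \<le> B * 0\<^sup>2"
      by (intro LIMSEQ_le_const) auto
    then show False
      by simp
  qed
  then show ?thesis
    using schwartz lim ge unfolding is_frame_def by blast
qed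

end
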